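(* Let $\mathcal{A}$ be an independence algebra with universe $A$ and let $\mathcal{B}$ be a non-empty subalgebra of $\mathcal{A}$ with universe $B$. Assume $\mathcal{B}\neq\mathcal{A}$ and that either $\dim B\geq 2$, or $\langle\emptyset\rangle\neq\emptyset$ and $\dim B=1$. Let $T(\mathcal{A},\mathcal{B})$ be the semigroup of all endomorphisms of $\mathcal{A}$ whose image is contained in $B$, let $Q=\{\alpha\in T(\mathcal{A},\mathcal{B}): A\alpha\subseteq B\alpha\}$ and $Q^c=T(\mathcal{A},\mathcal{B})\setminus Q$. For $\alpha,\beta\in T(\mathcal{A},\mathcal{B})$ we have $\alpha\,\widetilde{\mathcal{R}}\,\beta$ in $T(\mathcal{A},\mathcal{B})$ if and only if $\alpha,\beta\in Q^c$ or ($\ker\alpha=\ker\beta$ and $\alpha,\beta\in Q$).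
   Context: An algebra $\mathcal{A}=\langle A;F\rangle$ has a non-empty universe $A$ and a set $F$ of finitary operations. For $X\subseteq A$, $\langle X\rangle$ is the set of all $t(a_1,\dots,a_n)$ with $t$ a term operation and $a_i\in X$ (the subalgebra generated by $X$); $\langle\emptyset\rangle$ is the set of constants, i.e. values of nullary term operations (possibly empty). $X$ is independent if $x\notin\langle X\setminus\{x\}\rangle$ for all $x\in X$; a basis of a subalgebra is an independent generating set. Exchange property (EP): for all $X\subseteq A$ and $a,b\in A$, if $b\in\langle X\cup\{a\}\rangle$ and $b\notin\langle X\rangle$ then $a\in\langle X\cup\{b\}\rangle$. Under (EP) every subalgebra has a basis, all its bases have the same cardinality (its dimension, $\dim$), and independent sets extend to bases. Free basis property (F): every map from a basis of $\mathcal{A}$ to $A$ extends to an endomorphism of $\mathcal{A}$. An independence algebra is an algebra satisfying (EP) and (F). Dimensions may be finite or infinite. Maps are written on the right and composed left to right. $\ker\alpha=\{(x,y)\in A\times A: x\alpha=y\alpha\}$. For a semigroup $S$ with set of idempotents $E(S)$ and $a,b\in S$: $a\,\widetilde{\mathcal{R}}\,b$ iff for all $f\in E(S)$, $fa=a\Leftrightarrow fb=b$. *)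

theory Defs
  imports "HOL-Library.FuncSet"
begin

unbundle cardinal_syntax

(* An algebra is given by its universe A and its set F of finitary operations.  An n-ary operation
   is a pair (n, f), where f is applied to argument lists; only the values of f on lists of
   length n over A matter. *)
type_synonym 'a op_set = "(nat \<times> ('a list \<Rightarrow> 'a)) set"

definition algebra_on :: "'a set \<Rightarrow> 'a op_set \<Rightarrow> bool" where
  "algebra_on A F \<longleftrightarrow>
     A \<noteq> {} \<and> (\<forall>(n, f)\<in>F. \<forall>xs. length xs = n \<and> set xs \<subseteq> A \<longrightarrow> f xs \<in> A)"

(* Subalgebras may be empty here. *)
definition subalgebra_of :: "'a set \<Rightarrow> 'a set \<Rightarrow> 'a op_set \<Rightarrow> bool" where
  "subalgebra_of B A F \<longleftrightarrow>
     B \<subseteq> A \<and> (\<forall>(n, f)\<in>F. \<forall>xs. length xs = n \<and> set xs \<subseteq> B \<longrightarrow> f xs \<in> B)"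

(* term_op F n t: t is an n-ary term operation, i.e. t is obtained from the n-ary projections by
   composition with the operations in F.  The nullary ones are built from nullary operations in F
   and are constants. *)
inductive term_op :: "'a op_set \<Rightarrow> nat \<Rightarrow> ('a list \<Rightarrow> 'a) \<Rightarrow> bool"
  for F :: "'a op_set" and n :: nat
where
  proj: "i < n \<Longrightarrow> term_op F n (\<lambda>xs. xs ! i)"
| comp: "(length ts, f) \<in> F \<Longrightarrow> (\<forall>t\<in>set ts. term_op F n t) \<Longrightarrow>
           term_op F n (\<lambda>xs. f (map (\<lambda>t. t xs) ts))"

definition gen :: "'a op_set \<Rightarrow> 'a set \<Rightarrow> 'a set" where
  "gen F X = {t xs | n t xs. term_op F n t \<and> length xs = n \<and> set xs \<subseteq> X}"

definition indep_set :: "'a op_set \<Rightarrow> 'a set \<Rightarrow> bool" where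
  "indep_set F X \<longleftrightarrow> (\<forall>x\<in>X. x \<notin> gen F (X - {x}))"

definition basis_of :: "'a op_set \<Rightarrow> 'a set \<Rightarrow> 'a set \<Rightarrow> bool" where
  "basis_of F B X \<longleftrightarrow> X \<subseteq> B \<and> indep_set F X \<and> gen F X = B"

(* The cardinality of a basis.  Under the exchange property every subalgebra has a basis and all
   its bases have the same cardinality, so the choice is immaterial there. *)
definition alg_dim :: "'a op_set \<Rightarrow> 'a set \<Rightarrow> 'a rel" where
  "alg_dim F B = card_of (SOME X. basis_of F B X)"

definition exchange_property :: "'a set \<Rightarrow> 'a op_set \<Rightarrow> bool" where
  "exchange_property A F \<longleftrightarrow>
     (\<forall>X a b. X \<subseteq> A \<and> a \<in> A \<and> b \<in> A \<and> b \<in> gen F (insert a X) \<and> b \<notin> gen F X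
        \<longrightarrow> a \<in> gen F (insert b X))"

(* Maps on A are represented as extensional functions, so that equality of endomorphisms is
   equality of functions. *)
definition endomorphisms :: "'a set \<Rightarrow> 'a op_set \<Rightarrow> ('a \<Rightarrow> 'a) set" where
  "endomorphisms A F =
     {\<alpha> \<in> A \<rightarrow>\<^sub>E A. \<forall>(n, f)\<in>F. \<forall>xs. length xs = n \<and> set xs \<subseteq> A \<longrightarrow> \<alpha> (f xs) = f (map \<alpha> xs)}"

definition free_basis_property :: "'a set \<Rightarrow> 'a op_set \<Rightarrow> bool" where
  "free_basis_property A F \<longleftrightarrow>
     (\<forall>X \<phi>. basis_of F A X \<and> \<phi> \<in> X \<rightarrow> A \<longrightarrow> (\<exists>\<theta>\<in>endomorphisms A F. \<forall>x\<in>X. \<theta> x = \<phi> x))"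

definition independence_algebra :: "'a set \<Rightarrow> 'a op_set \<Rightarrow> bool" where
  "independence_algebra A F \<longleftrightarrow>
     algebra_on A F \<and> exchange_property A F \<and> free_basis_property A F"

(* Maps are composed from left to right: x(\<alpha>\<beta>) = (x\<alpha>)\<beta>. *)
definition rcomp :: "'a set \<Rightarrow> ('a \<Rightarrow> 'a) \<Rightarrow> ('a \<Rightarrow> 'a) \<Rightarrow> ('a \<Rightarrow> 'a)" where
  "rcomp A \<alpha> \<beta> = compose A \<beta> \<alpha>"

definition ker_on :: "'a set \<Rightarrow> ('a \<Rightarrow> 'a) \<Rightarrow> ('a \<times> 'a) set" where
  "ker_on A \<alpha> = {(x, y) \<in> A \<times> A. \<alpha> x = \<alpha> y}"

definition idempotents :: "'s set \<Rightarrow> ('s \<Rightarrow> 's \<Rightarrow> 's) \<Rightarrow> 's set" where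
  "idempotents S m = {e \<in> S. m e e = e}"

definition R_tilde :: "'s set \<Rightarrow> ('s \<Rightarrow> 's \<Rightarrow> 's) \<Rightarrow> 's \<Rightarrow> 's \<Rightarrow> bool" where
  "R_tilde S m a b \<longleftrightarrow>
     a \<in> S \<and> b \<in> S \<and> (\<forall>f\<in>idempotents S m. m f a = a \<longleftrightarrow> m f b = b)"

definition T_sub :: "'a set \<Rightarrow> 'a op_set \<Rightarrow> 'a set \<Rightarrow> ('a \<Rightarrow> 'a) set" where
  "T_sub A F B = {\<alpha> \<in> endomorphisms A F. \<alpha> ` A \<subseteq> B}"

definition Q_sub :: "'a set \<Rightarrow> 'a op_set \<Rightarrow> 'a set \<Rightarrow> ('a \<Rightarrow> 'a) set" where
  "Q_sub A F B = {\<alpha> \<in> T_sub A F B. \<alpha> ` A \<subseteq> \<alpha> ` B}"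

definition Qc_sub :: "'a set \<Rightarrow> 'a op_set \<Rightarrow> 'a set \<Rightarrow> ('a \<Rightarrow> 'a) set" where
  "Qc_sub A F B = T_sub A F B - Q_sub A F B"

end

theory Submission
  imports Defs
begin

text \<open>
  A solution \<open>f\<close> of \<open>f\<alpha> = \<alpha>\<close> in \<open>T(A,B)\<close> forces \<open>A\<alpha> = (Af)\<alpha> \<subseteq> B\<alpha>\<close>, so elements of \<open>Q\<^sup>c\<close> have no
  left identity.  Conversely let \<open>\<alpha> \<in> Q\<close>.  Extend a basis \<open>Y\<close> of \<open>A\<alpha>\<close> to a basis of \<open>A\<close> and let \<open>g\<close>
  be an endomorphism into \<open>B\<close> sending each \<open>y \<in> Y\<close> to an \<open>\<alpha>\<close>-preimage in \<open>B\<close>.  Then \<open>\<alpha>g\<alpha> = \<alpha>\<close>, so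
  \<open>\<alpha>g\<close> is an idempotent left identity of \<open>\<alpha>\<close> with the same kernel as \<open>\<alpha>\<close>.  Since \<open>f\<alpha> = \<alpha>\<close> only says
  that \<open>(xf, x) \<in> ker \<alpha>\<close> for all \<open>x\<close>, the relation on \<open>Q\<close> is equality of kernels.
\<close>

section \<open>Term operations and generated subalgebras\<close>

lemma subalgebra_op_closed:
  "subalgebra_of C A F \<Longrightarrow> (length xs, f) \<in> F \<Longrightarrow> set xs \<subseteq> C \<Longrightarrow> f xs \<in> C"
  unfolding subalgebra_of_def by (drule conjunct2) (drule (1) bspec, simp)

lemma term_op_closed:
  assumes "term_op F n t" "subalgebra_of C A F" "length xs = n" "set xs \<subseteq> C"
  shows "t xs \<in> C"
  using assms(1)
proof induction
  case (proj i)
  then show ?case using assms by (simp add: subset_iff)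
next
  case (comp ts f)
  then have "set (map (\<lambda>t. t xs) ts) \<subseteq> C" by auto
  then show ?case
    using subalgebra_op_closed[OF assms(2), of "map (\<lambda>t. t xs) ts" f] comp.hyps(1) by simp
qed

lemma gen_subset:
  assumes "subalgebra_of C A F" "X \<subseteq> C"
  shows "gen F X \<subseteq> C"
  using assms term_op_closed[OF _ assms(1)] unfolding gen_def by blast

lemma subset_gen: "X \<subseteq> gen F X"
proof
  fix x assume "x \<in> X"
  moreover have "term_op F 1 (\<lambda>xs. xs ! 0)" by (rule term_op.proj) simp
  ultimately show "x \<in> gen F X"
    unfolding gen_def by (intro CollectI exI[of _ 1] exI[of _ "\<lambda>xs. xs ! 0"] exI[of _ "[x]"]) auto
qed

lemma gen_mono: "X \<subseteq> Y \<Longrightarrow> gen F X \<subseteq> gen F Y"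
  unfolding gen_def by blast

text \<open>A term operation reads only finitely many arguments, and these form \<open>W\<close>.
  This finitary character makes Zorn's lemma applicable to independent sets.\<close>

lemma gen_finitary:
  assumes "x \<in> gen F X"
  obtains W where "finite W" "W \<subseteq> X" "x \<in> gen F W"
proof -
  from assms obtain t xs where "term_op F (length xs) t" "set xs \<subseteq> X" "x = t xs"
    unfolding gen_def by blast
  then have "x \<in> gen F (set xs)" unfolding gen_def by blast
  with \<open>set xs \<subseteq> X\<close> show ?thesis using that by blast
qed

lemma subalgebra_of_self: "algebra_on A F \<Longrightarrow> subalgebra_of A A F"
  by (simp add: algebra_on_def subalgebra_of_def)

section \<open>Independent sets and bases\<close>

lemma indep_set_Union_chain:
  assumes chain: "subset.chain {Y. indep_set F Y} \<C>"
  shows "indep_set F (\<Union>\<C>)"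
  unfolding indep_set_def
proof (intro ballI notI)
  fix x assume x: "x \<in> \<Union>\<C>" and "x \<in> gen F (\<Union>\<C> - {x})"
  then obtain W where W: "finite W" "W \<subseteq> \<Union>\<C> - {x}" "x \<in> gen F W"
    by (rule_tac gen_finitary)
  \<comment> \<open>The dependence of \<open>x\<close> involves finitely many elements, so it
    already occurs inside one member of the chain.\<close>
  have "finite (insert x W)" "insert x W \<subseteq> \<Union>\<C>" "\<C> \<noteq> {}"
    using W x by auto
  then obtain D where D: "D \<in> \<C>" "insert x W \<subseteq> D"
    using finite_subset_Union_chain[OF _ _ _ chain] by blast
  then have "indep_set F D" using chain by (auto simp: subset.chain_def)
  moreover have "gen F W \<subseteq> gen F (D - {x})" using D W by (intro gen_mono) auto
  ultimately show False using D W unfolding indep_set_def by blast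
qed

lemma indep_set_insert:
  assumes "exchange_property A F" "Y \<subseteq> A" "z \<in> A" "indep_set F Y" "z \<notin> gen F Y"
  shows "indep_set F (insert z Y)"
  unfolding indep_set_def
proof (intro ballI notI)
  fix x assume x: "x \<in> insert z Y" "x \<in> gen F (insert z Y - {x})"
  have zY: "z \<notin> Y" using assms(5) subset_gen[of Y F] by blast
  show False
  proof (cases "x = z")
    case True
    then show False using x zY assms(5) by simp
  next
    case False
    then have "x \<in> Y" "insert z Y - {x} = insert z (Y - {x})" using x by auto
    moreover from \<open>x \<in> Y\<close> have "x \<notin> gen F (Y - {x})" using assms(4) by (auto simp: indep_set_def)
    \<comment> \<open>Exchange over \<open>Y - {x}\<close>: a dependence of \<open>x\<close> that
      appears only after adding \<open>z\<close> makes \<open>z\<close> depend on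
      \<open>Y - {x}\<close> together with \<open>x\<close>, that is, on \<open>Y\<close>.\<close>
    ultimately have "z \<in> gen F (insert x (Y - {x}))"
      using assms(1)[unfolded exchange_property_def, rule_format, of "Y - {x}" z x] assms(2,3) x(2)
      by (auto simp: subset_iff)
    with \<open>x \<in> Y\<close> show False using assms(5) by (simp add: insert_absorb)
  qed
qed

text \<open>Zorn's lemma gives a maximal independent \<open>Y\<close> between \<open>I\<close> and
  \<open>C\<close>; any element of \<open>C\<close> outside \<open>gen F Y\<close> could be added to
  it. With \<open>I\<close> empty this yields a basis of an image, with \<open>C = A\<close> it
  extends that basis to all of \<open>A\<close>.\<close>

lemma indep_set_extends_to_basis:
  assumes ep: "exchange_property A F" and C: "subalgebra_of C A F"
    and I: "I \<subseteq> C" "indep_set F I"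
  obtains Y where "I \<subseteq> Y" "basis_of F C Y"
proof -
  let ?P = "{Y. I \<subseteq> Y \<and> Y \<subseteq> C \<and> indep_set F Y}"
  have "\<exists>M\<in>?P. \<forall>X\<in>?P. M \<subseteq> X \<longrightarrow> X = M"
  proof (rule subset_Zorn_nonempty)
    show "?P \<noteq> {}" using I by blast
    fix \<C> assume "\<C> \<noteq> {}" and ch: "subset.chain ?P \<C>"
    have P: "I \<subseteq> D" "D \<subseteq> C" if "D \<in> \<C>" for D
      using ch that by (auto simp: subset.chain_def)
    have "subset.chain {Y. indep_set F Y} \<C>" using ch by (auto simp: subset.chain_def)
    then have "indep_set F (\<Union>\<C>)" by (rule indep_set_Union_chain)
    \<comment> \<open>The union of an empty chain could miss \<open>I\<close>; the chosen form of
      Zorn's lemma considers non-empty chains only.\<close>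
    moreover have "I \<subseteq> \<Union>\<C>" using P(1) \<open>\<C> \<noteq> {}\<close> by blast
    moreover have "\<Union>\<C> \<subseteq> C" using P(2) by blast
    ultimately show "\<Union>\<C> \<in> ?P" by blast
  qed
  then obtain Y where Y: "I \<subseteq> Y" "Y \<subseteq> C" "indep_set F Y"
    and max: "\<And>X. X \<in> ?P \<Longrightarrow> Y \<subseteq> X \<Longrightarrow> X = Y" by auto
  have CA: "C \<subseteq> A" using C by (simp add: subalgebra_of_def)
  have "C \<subseteq> gen F Y"
  proof (rule subsetI, rule ccontr)
    fix z assume z: "z \<in> C" "z \<notin> gen F Y"
    then have "indep_set F (insert z Y)"
      using indep_set_insert[OF ep _ _ Y(3)] Y(2) CA by blast
    then have "insert z Y = Y" using max[of "insert z Y"] Y z by blast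
    then show False using z subset_gen[of Y F] by blast
  qed
  then have "basis_of F C Y"
    using Y gen_subset[OF C Y(2)] by (auto simp: basis_of_def)
  with Y(1) show ?thesis by (rule that)
qed

section \<open>Endomorphisms, term operations and images\<close>

lemma endomorphism_range: "\<theta> \<in> endomorphisms A F \<Longrightarrow> x \<in> A \<Longrightarrow> \<theta> x \<in> A"
  unfolding endomorphisms_def by auto

lemma endomorphism_op:
  "\<theta> \<in> endomorphisms A F \<Longrightarrow> (n, f) \<in> F \<Longrightarrow> length xs = n \<Longrightarrow> set xs \<subseteq> A
    \<Longrightarrow> \<theta> (f xs) = f (map \<theta> xs)"
  unfolding endomorphisms_def by (drule CollectD, drule conjunct2) (drule (1) bspec, simp)

lemma endomorphism_term_op:
  assumes "term_op F n t" "algebra_on A F" "\<theta> \<in> endomorphisms A F" "length xs = n" "set xs \<subseteq> A"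
  shows "\<theta> (t xs) = t (map \<theta> xs)"
  using assms(1)
proof induction
  case (proj i)
  then show ?case using assms by simp
next
  case (comp ts f)
  have "set (map (\<lambda>t. t xs) ts) \<subseteq> A"
    using comp term_op_closed[OF _ subalgebra_of_self[OF assms(2)] assms(4,5)] by auto
  then have "\<theta> (f (map (\<lambda>t. t xs) ts)) = f (map \<theta> (map (\<lambda>t. t xs) ts))"
    using endomorphism_op[OF assms(3) comp.hyps(1)] by simp
  also have "map \<theta> (map (\<lambda>t. t xs) ts) = map (\<lambda>t. t (map \<theta> xs)) ts"
    using comp by simp
  finally show ?case .
qed

lemma endomorphism_gen_subset:
  assumes "algebra_on A F" "\<theta> \<in> endomorphisms A F" "subalgebra_of B A F" "X \<subseteq> A" "\<theta> ` X \<subseteq> B"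
  shows "\<theta> ` gen F X \<subseteq> B"
proof
  fix y assume "y \<in> \<theta> ` gen F X"
  then obtain t xs where t: "term_op F (length xs) t" "set xs \<subseteq> X" "y = \<theta> (t xs)"
    unfolding gen_def by blast
  then have "y = t (map \<theta> xs)" using endomorphism_term_op assms by blast
  moreover have "set (map \<theta> xs) \<subseteq> B" using t assms(5) by auto
  ultimately show "y \<in> B" using term_op_closed[OF t(1) assms(3)] by simp
qed

lemma endomorphism_gen_fixes:
  assumes "algebra_on A F" "\<theta> \<in> endomorphisms A F" "X \<subseteq> A" "\<And>x. x \<in> X \<Longrightarrow> \<theta> x = x"
    and "y \<in> gen F X"
  shows "\<theta> y = y"
proof -
  obtain t xs where t: "term_op F (length xs) t" "set xs \<subseteq> X" "y = t xs"
    using assms(5) unfolding gen_def by blast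
  then have "\<theta> y = t (map \<theta> xs)" using endomorphism_term_op assms by blast
  also have "map \<theta> xs = xs" using t assms(4) by (auto intro: map_idI)
  finally show ?thesis using t by simp
qed

lemma endomorphism_image_subalgebra:
  assumes "algebra_on A F" "\<theta> \<in> endomorphisms A F"
  shows "subalgebra_of (\<theta> ` A) A F"
  unfolding subalgebra_of_def
proof (intro conjI ballI, goal_cases)
  case 1
  then show ?case using endomorphism_range[OF assms(2)] by blast
next
  case (2 p)
  have "f xs \<in> \<theta> ` A" if f: "(length xs, f) \<in> F" and xs: "set xs \<subseteq> \<theta> ` A" for f xs
  proof -
    \<comment> \<open>Choosing preimages entry by entry exhibits \<open>f xs\<close> as the image of
      \<open>f ys\<close>.\<close>
    obtain ys where ys: "xs = map \<theta> ys" "set ys \<subseteq> A"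
    proof
      show "xs = map \<theta> (map (inv_into A \<theta>) xs)"
        using xs by (simp add: map_idI f_inv_into_f subset_iff)
      show "set (map (inv_into A \<theta>) xs) \<subseteq> A"
        using xs by (auto intro: inv_into_into)
    qed
    have "f ys \<in> A" using subalgebra_op_closed[OF subalgebra_of_self[OF assms(1)], of ys f] f ys by simp
    moreover have "\<theta> (f ys) = f xs" using endomorphism_op[OF assms(2) f] ys by simp
    ultimately show ?thesis by (metis imageI)
  qed
  with 2 show ?case by auto
qed

section \<open>Composition and left identities\<close>

lemma rcomp_apply: "x \<in> A \<Longrightarrow> rcomp A \<alpha> \<beta> x = \<beta> (\<alpha> x)"
  by (simp add: rcomp_def compose_def)

lemma rcomp_endomorphism:
  assumes "algebra_on A F" "\<alpha> \<in> endomorphisms A F" "\<beta> \<in> endomorphisms A F"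
  shows "rcomp A \<alpha> \<beta> \<in> endomorphisms A F"
proof -
  have "rcomp A \<alpha> \<beta> (f xs) = f (map (rcomp A \<alpha> \<beta>) xs)"
    if f: "(length xs, f) \<in> F" and xs: "set xs \<subseteq> A" for f xs
  proof -
    have "f xs \<in> A" using subalgebra_op_closed[OF subalgebra_of_self[OF assms(1)] f xs] .
    then have "rcomp A \<alpha> \<beta> (f xs) = \<beta> (f (map \<alpha> xs))"
      using endomorphism_op[OF assms(2) f] xs by (simp add: rcomp_apply)
    also have "\<dots> = f (map \<beta> (map \<alpha> xs))"
      using endomorphism_op[OF assms(3) f, of "map \<alpha> xs"] endomorphism_range[OF assms(2)] xs
      by (auto simp: subset_iff)
    also have "map \<beta> (map \<alpha> xs) = map (rcomp A \<alpha> \<beta>) xs"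
      using xs by (auto simp: rcomp_apply)
    finally show ?thesis .
  qed
  moreover have "rcomp A \<alpha> \<beta> \<in> A \<rightarrow>\<^sub>E A"
    using assms(2,3)[THEN endomorphism_range] by (auto simp: rcomp_def compose_def)
  ultimately show ?thesis by (auto simp: endomorphisms_def)
qed

lemma rcomp_eq_iff:
  assumes "\<alpha> \<in> endomorphisms A F"
  shows "rcomp A f \<alpha> = \<alpha> \<longleftrightarrow> (\<forall>x\<in>A. \<alpha> (f x) = \<alpha> x)"
proof
  assume "rcomp A f \<alpha> = \<alpha>"
  then show "\<forall>x\<in>A. \<alpha> (f x) = \<alpha> x" by (metis rcomp_apply)
next
  assume "\<forall>x\<in>A. \<alpha> (f x) = \<alpha> x"
  \<comment> \<open>Outside \<open>A\<close> both sides take the default value of extensional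
    functions, so agreement on \<open>A\<close> suffices.\<close>
  moreover have "\<alpha> \<in> extensional A" using assms by (auto simp: endomorphisms_def PiE_def)
  ultimately show "rcomp A f \<alpha> = \<alpha>"
    by (auto simp: rcomp_def compose_def extensional_def fun_eq_iff)
qed

text \<open>Each value \<open>\<alpha> x\<close> equals \<open>\<alpha> (f x)\<close> with
  \<open>f x\<close> in \<open>B\<close>. Read contrapositively, both sides of the condition
  defining \<open>R_tilde\<close> fail on the complement of Q.\<close>

lemma rcomp_eq_imp_Q_sub:
  assumes "\<alpha> \<in> T_sub A F B" "f \<in> T_sub A F B" "rcomp A f \<alpha> = \<alpha>"
  shows "\<alpha> \<in> Q_sub A F B"
proof -
  have "\<forall>x\<in>A. \<alpha> (f x) = \<alpha> x"
    using assms(1,3) rcomp_eq_iff unfolding T_sub_def by blast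
  then have "\<alpha> ` A \<subseteq> \<alpha> ` B"
    using assms(2) unfolding T_sub_def by (auto simp: image_subset_iff) (metis imageI)
  with assms(1) show ?thesis by (simp add: Q_sub_def)
qed

text \<open>The free basis property allows \<open>g\<close> to be prescribed on a basis
  \<open>X\<close> of \<open>A\<close> that contains a basis \<open>Y\<close> of the image of
  \<open>\<alpha>\<close>. Membership in Q is what places the required preimages in
  \<open>B\<close>.\<close>

lemma Q_sub_inner_inverse:
  assumes "independence_algebra A F" "subalgebra_of B A F" "B \<noteq> {}" "\<alpha> \<in> Q_sub A F B"
  obtains g where "g \<in> T_sub A F B" "\<And>x. x \<in> A \<Longrightarrow> \<alpha> (g (\<alpha> x)) = \<alpha> x"
proof -
  have alg: "algebra_on A F" and ep: "exchange_property A F" and fb: "free_basis_property A F"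
    using assms(1) by (auto simp: independence_algebra_def)
  have \<alpha>: "\<alpha> \<in> endomorphisms A F" "\<alpha> ` A \<subseteq> \<alpha> ` B"
    using assms(4) by (auto simp: Q_sub_def T_sub_def)
  have BA: "B \<subseteq> A" using assms(2) by (simp add: subalgebra_of_def)
  have "indep_set F {}" by (simp add: indep_set_def)
  then obtain Y where Y: "basis_of F (\<alpha> ` A) Y"
    using indep_set_extends_to_basis[OF ep endomorphism_image_subalgebra[OF alg \<alpha>(1)]]
    by (metis empty_subsetI)
  then have Y': "Y \<subseteq> \<alpha> ` A" "indep_set F Y" "gen F Y = \<alpha> ` A" by (auto simp: basis_of_def)
  have YA: "Y \<subseteq> A" using Y' endomorphism_range[OF \<alpha>(1)] by blast
  obtain X where X: "Y \<subseteq> X" "basis_of F A X"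
    using indep_set_extends_to_basis[OF ep subalgebra_of_self[OF alg] YA Y'(2)] by metis
  have "\<forall>y\<in>Y. \<exists>b\<in>B. \<alpha> b = y" using Y' \<alpha> by (force simp: image_subset_iff)
  then obtain s where s: "\<And>y. y \<in> Y \<Longrightarrow> s y \<in> B" "\<And>y. y \<in> Y \<Longrightarrow> \<alpha> (s y) = y" by metis
  obtain b where b: "b \<in> B" using assms(3) by blast
  \<comment> \<open>Basis elements outside \<open>Y\<close> go to an arbitrary \<open>b\<close> in
    \<open>B\<close>, which keeps the whole image of \<open>g\<close> inside
    \<open>B\<close>.\<close>
  define \<phi> where "\<phi> y = (if y \<in> Y then s y else b)" for y
  have \<phi>B: "\<phi> y \<in> B" for y using s b by (simp add: \<phi>_def)
  then have "\<phi> \<in> X \<rightarrow> A" using BA by blast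
  then obtain g where g: "g \<in> endomorphisms A F" "\<And>x. x \<in> X \<Longrightarrow> g x = \<phi> x"
    using fb X(2) unfolding free_basis_property_def by metis
  have "X \<subseteq> A" "gen F X = A" using X(2) by (auto simp: basis_of_def)
  then have "g ` A \<subseteq> B"
    using endomorphism_gen_subset[OF alg g(1) assms(2) \<open>X \<subseteq> A\<close>] g(2) \<phi>B by auto
  then have gT: "g \<in> T_sub A F B" using g by (simp add: T_sub_def)
  \<comment> \<open>First \<open>g\<close>, then \<open>\<alpha>\<close>, fixes \<open>Y\<close>
    pointwise, hence everything \<open>Y\<close> generates, which is the image of
    \<open>\<alpha>\<close>.\<close>
  have "rcomp A g \<alpha> y = y" if "y \<in> gen F Y" for y
  proof (rule endomorphism_gen_fixes[OF alg rcomp_endomorphism[OF alg g(1) \<alpha>(1)] YA _ that])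
    fix x assume "x \<in> Y"
    then show "rcomp A g \<alpha> x = x"
      using YA X(1) s(2) g(2)[of x] by (simp add: rcomp_apply \<phi>_def subset_iff)
  qed
  then have "\<alpha> (g (\<alpha> x)) = \<alpha> x" if "x \<in> A" for x
    using that Y'(3) endomorphism_range[OF \<alpha>(1) that] by (metis imageI rcomp_apply)
  with gT show ?thesis by (rule that)
qed

lemma Q_sub_idempotent_left_identity:
  assumes "independence_algebra A F" "subalgebra_of B A F" "B \<noteq> {}" "\<alpha> \<in> Q_sub A F B"
  obtains f where "f \<in> idempotents (T_sub A F B) (rcomp A)" "rcomp A f \<alpha> = \<alpha>"
    "ker_on A f = ker_on A \<alpha>"
proof -
  have alg: "algebra_on A F" using assms(1) by (simp add: independence_algebra_def)
  have \<alpha>: "\<alpha> \<in> endomorphisms A F" using assms(4) by (auto simp: Q_sub_def T_sub_def)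
  obtain g where gT: "g \<in> T_sub A F B" and g: "\<And>x. x \<in> A \<Longrightarrow> \<alpha> (g (\<alpha> x)) = \<alpha> x"
    using Q_sub_inner_inverse[OF assms] by blast
  let ?f = "rcomp A \<alpha> g"
  have f: "?f \<in> endomorphisms A F"
    using rcomp_endomorphism[OF alg \<alpha>] gT by (simp add: T_sub_def)
  have fx: "?f x = g (\<alpha> x)" if "x \<in> A" for x using that by (rule rcomp_apply)
  have "?f ` A \<subseteq> B"
    using gT endomorphism_range[OF \<alpha>] fx by (auto simp: T_sub_def)
  \<comment> \<open>Pointwise this is \<open>g (\<alpha> (g (\<alpha> x))) = g (\<alpha> x)\<close>,
    the inner inverse law under \<open>g\<close>.\<close>
  moreover have "rcomp A ?f ?f = ?f"
    using endomorphism_range[OF f] by (simp add: rcomp_eq_iff[OF f] fx g)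
  ultimately have "?f \<in> idempotents (T_sub A F B) (rcomp A)"
    using f by (simp add: idempotents_def T_sub_def)
  moreover have "rcomp A ?f \<alpha> = \<alpha>" by (simp add: rcomp_eq_iff[OF \<alpha>] fx g)
  \<comment> \<open>Applying \<open>\<alpha>\<close> to
    \<open>g (\<alpha> x) = g (\<alpha> y)\<close> recovers \<open>\<alpha> x = \<alpha> y\<close>,
    so \<open>g\<close> identifies nothing new.\<close>
  moreover have "ker_on A ?f = ker_on A \<alpha>"
    using g fx by (auto simp: ker_on_def) metis
  ultimately show ?thesis by (rule that)
qed

section \<open>The relation on Q and on its complement\<close>

lemma R_tilde_sym: "R_tilde S m a b \<Longrightarrow> R_tilde S m b a"
  unfolding R_tilde_def by blast

text \<open>The idempotent left identity of \<open>\<alpha>\<close> is also one of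
  \<open>\<beta>\<close>. This puts \<open>\<beta>\<close> in Q, and its kernel, which is that of
  \<open>\<alpha>\<close>, is contained in the kernel of \<open>\<beta>\<close>.\<close>

lemma R_tilde_Q_sub:
  assumes "independence_algebra A F" "subalgebra_of B A F" "B \<noteq> {}" "\<alpha> \<in> Q_sub A F B"
    and R: "R_tilde (T_sub A F B) (rcomp A) \<alpha> \<beta>"
  shows "\<beta> \<in> Q_sub A F B" "ker_on A \<alpha> \<subseteq> ker_on A \<beta>"
proof -
  obtain f where f: "f \<in> idempotents (T_sub A F B) (rcomp A)" "rcomp A f \<alpha> = \<alpha>"
    "ker_on A f = ker_on A \<alpha>"
    using Q_sub_idempotent_left_identity[OF assms(1-4)] by blast
  have f\<beta>: "rcomp A f \<beta> = \<beta>" and \<beta>: "\<beta> \<in> T_sub A F B"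
    using R f unfolding R_tilde_def by blast+
  show "\<beta> \<in> Q_sub A F B"
    using rcomp_eq_imp_Q_sub[OF \<beta> _ f\<beta>] f(1) by (simp add: idempotents_def)
  have "\<forall>x\<in>A. \<beta> (f x) = \<beta> x"
    using f\<beta> \<beta> rcomp_eq_iff unfolding T_sub_def by blast
  then have "ker_on A f \<subseteq> ker_on A \<beta>" by (auto simp: ker_on_def) metis
  with f(3) show "ker_on A \<alpha> \<subseteq> ker_on A \<beta>" by simp
qed

text \<open>Shows that being fixed by \<open>f\<close> on the left depends on
  \<open>\<alpha>\<close> only through its kernel.\<close>

lemma rcomp_eq_iff_ker_on:
  assumes "\<alpha> \<in> endomorphisms A F" "f \<in> endomorphisms A F"
  shows "rcomp A f \<alpha> = \<alpha> \<longleftrightarrow> (\<forall>x\<in>A. (f x, x) \<in> ker_on A \<alpha>)"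
  using endomorphism_range[OF assms(2)] by (auto simp: rcomp_eq_iff[OF assms(1)] ker_on_def)

theorem proposition6p4:
  fixes A B :: "'a set" and F :: "'a op_set" and \<alpha> \<beta> :: "'a \<Rightarrow> 'a"
  assumes "independence_algebra A F"
    and "subalgebra_of B A F" and "B \<noteq> {}" and "B \<noteq> A"
    and "ctwo \<le>o alg_dim F B \<or> (gen F {} \<noteq> {} \<and> alg_dim F B =o cone)"
    and "\<alpha> \<in> T_sub A F B" and "\<beta> \<in> T_sub A F B"
  shows "R_tilde (T_sub A F B) (rcomp A) \<alpha> \<beta> \<longleftrightarrow>
    (\<alpha> \<in> Qc_sub A F B \<and> \<beta> \<in> Qc_sub A F B) \<or>
    (ker_on A \<alpha> = ker_on A \<beta> \<and> \<alpha> \<in> Q_sub A F B \<and> \<beta> \<in> Q_sub A F B)"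
    (is "?R \<longleftrightarrow> ?Qc \<or> ?Q")
proof
  assume R: ?R
  note fwd = R_tilde_Q_sub[OF assms(1-3)]
  show "?Qc \<or> ?Q"
  proof (cases "\<alpha> \<in> Q_sub A F B")
    case True
    \<comment> \<open>Using the relation in both directions gives the two kernel inclusions.\<close>
    then show ?thesis using fwd[OF True R] fwd[OF _ R_tilde_sym[OF R]] by blast
  next
    case False
    then have "\<beta> \<notin> Q_sub A F B" using fwd(1)[OF _ R_tilde_sym[OF R]] by blast
    with False show ?thesis using assms(6,7) by (simp add: Qc_sub_def)
  qed
next
  \<comment> \<open>The equivalence is shown for every \<open>f\<close> in the semigroup and
    specialised to idempotents at the end.\<close>
  have "rcomp A f \<alpha> = \<alpha> \<longleftrightarrow> rcomp A f \<beta> = \<beta>"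
    if f: "f \<in> T_sub A F B" and "?Qc \<or> ?Q" for f
    using that(2)
  proof
    assume ?Qc
    then show ?thesis
      using rcomp_eq_imp_Q_sub[OF _ f] assms(6,7) by (auto simp: Qc_sub_def)
  next
    assume ?Q
    then show ?thesis
      using rcomp_eq_iff_ker_on[of \<alpha> A F f] rcomp_eq_iff_ker_on[of \<beta> A F f] f assms(6,7)
      by (simp add: T_sub_def)
  qed
  moreover assume "?Qc \<or> ?Q"
  ultimately show ?R
    using assms(6,7) by (auto simp: R_tilde_def idempotents_def)
qed

end
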